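(* Let $K$ be an algebraically closed field, $1\le d\le n-1$ integers, $X\le K^n$ a linear subspace of dimension $d+1$ with Plücker coordinates $(q_I)_{I\in\binom{[n]}{d+1}}$, and $S\subset[n]$. Suppose there is $C\in\binom{[n]}{d+1}$ with $S\subseteq C$ and $q_C\neq 0$. Then there is a $(d+1)$-dimensional linear subspace $X^S\le K^n$ such that $$L^S(X)=L(X^S).$$ In particular, $L^S(X)$ is a linear subvariety of $\mathbb{P}^{\binom{n}{d}-1}$ of (projective) dimension $d$.
   Context: $[n]=\{1,\dots,n\}$ and $\binom{[n]}{m}$ is the set of $m$-subsets of $[n]$. $\mathrm{Gr}(d,n)$ is the Grassmannian of $d$-dimensional linear subspaces of $K^n$, viewed as a subvariety of $\mathbb{P}^{\binom{n}{d}-1}$ via the Plücker embedding. For $S\subseteq[n]$, $\mathrm{pr}_S:K^n\to K^n$ is the linear coordinate projection sending $e_i$ to $0$ for $i\in S$ and fixing $e_i$ for $i\notin S$. For a $(d+1)$-dimensional subspace $X\le K^n$, $$L^S(X)=\{Y\in \mathrm{Gr}(d,n): \mathrm{pr}_S(Y)\subseteq X\}\subseteq\mathbb{P}^{\binom{n}{d}-1},\qquad L(X)=L^{\emptyset}(X).$$ *)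

theory Defs
  imports
    "Jordan_Normal_Form.Determinant"
    "HOL-Library.Function_Algebras"
    "HOL-Computational_Algebra.Polynomial"
begin

text \<open>
  For a finite index set \<open>A\<close>, the coordinate space \<open>K\<^sup>A\<close> is the set of functions vanishing outside \<open>A\<close>;
  in particular \<open>K\<^sup>n\<close> is \<open>coord_space {1..n}\<close>. Addition of functions is pointwise.
\<close>

definition fscale :: "'k::field \<Rightarrow> ('i \<Rightarrow> 'k) \<Rightarrow> 'i \<Rightarrow> 'k" where
  "fscale c x = (\<lambda>i. c * x i)"

global_interpretation fvs: vector_space "fscale :: 'k::field \<Rightarrow> ('i \<Rightarrow> 'k) \<Rightarrow> 'i \<Rightarrow> 'k"
  by unfold_locales (auto simp: fscale_def fun_eq_iff algebra_simps)

definition coord_space :: "'i set \<Rightarrow> ('i \<Rightarrow> 'k::field) set" where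
  "coord_space A = {x. \<forall>i. i \<notin> A \<longrightarrow> x i = 0}"

definition subsets_of_size :: "nat \<Rightarrow> nat \<Rightarrow> nat set set" where
  "subsets_of_size n m = {I. I \<subseteq> {1..n} \<and> card I = m}"

definition Gr :: "nat \<Rightarrow> nat \<Rightarrow> (nat \<Rightarrow> 'k::field) set set" where
  "Gr d n = {Y. Y \<subseteq> coord_space {1..n} \<and> fvs.subspace Y \<and> fvs.dim Y = d}"

definition ordered_basis :: "nat \<Rightarrow> (nat \<Rightarrow> nat \<Rightarrow> 'k::field) \<Rightarrow> (nat \<Rightarrow> 'k) set \<Rightarrow> bool" where
  "ordered_basis m b Y \<longleftrightarrow>
     inj_on b {..<m} \<and> fvs.independent (b ` {..<m}) \<and> fvs.span (b ` {..<m}) = Y"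

text \<open>
  The Pluecker coordinates of an \<open>m\<close>-dimensional subspace are the maximal minors of a matrix whose
  rows form a basis, the columns being taken in increasing order. They depend on the basis, but
  only up to a common nonzero factor, so they are introduced as a relation.
\<close>

definition plucker_coords ::
    "nat \<Rightarrow> nat \<Rightarrow> (nat \<Rightarrow> 'k::field) set \<Rightarrow> (nat set \<Rightarrow> 'k) \<Rightarrow> bool" where
  "plucker_coords m n Y q \<longleftrightarrow>
     (\<exists>b. ordered_basis m b Y \<and>
          q = (\<lambda>I. if I \<in> subsets_of_size n m
                    then det (mat m m (\<lambda>(i, j). b i (sorted_list_of_set I ! j))) else 0))"

text \<open>
  Points of a projective space are the lines through the origin of the underlying vector space.
  All Pluecker vectors of a subspace \<open>Y\<close> are proportional, so they span such a line.
\<close>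

definition plucker_point :: "nat \<Rightarrow> nat \<Rightarrow> (nat \<Rightarrow> 'k::field) set \<Rightarrow> (nat set \<Rightarrow> 'k) set" where
  "plucker_point d n Y = fvs.span {p. plucker_coords d n Y p}"

definition projectivization :: "('i \<Rightarrow> 'k::field) set \<Rightarrow> ('i \<Rightarrow> 'k) set set" where
  "projectivization W = {fvs.span {w} | w. w \<in> W \<and> w \<noteq> 0}"

text \<open>\<open>Z\<close> is a linear subvariety of projective dimension \<open>k\<close> of the projective space of \<open>K\<^sup>A\<close>.\<close>

definition linear_subvariety :: "'i set \<Rightarrow> nat \<Rightarrow> ('i \<Rightarrow> 'k::field) set set \<Rightarrow> bool" where
  "linear_subvariety A k Z \<longleftrightarrow>
     (\<exists>W. W \<subseteq> coord_space A \<and> fvs.subspace W \<and> fvs.dim W = k + 1 \<and> Z = projectivization W)"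

definition pr :: "nat set \<Rightarrow> (nat \<Rightarrow> 'k::field) \<Rightarrow> nat \<Rightarrow> 'k" where
  "pr S x = (\<lambda>i. if i \<in> S then 0 else x i)"

definition LS :: "nat \<Rightarrow> nat \<Rightarrow> nat set \<Rightarrow> (nat \<Rightarrow> 'k::field) set \<Rightarrow> (nat \<Rightarrow> 'k) set set" where
  "LS d n S X = {Y \<in> Gr d n. pr S ` Y \<subseteq> X}"

definition L :: "nat \<Rightarrow> nat \<Rightarrow> (nat \<Rightarrow> 'k::field) set \<Rightarrow> (nat \<Rightarrow> 'k) set set" where
  "L d n X = LS d n {} X"

end

theory Submission
  imports Defs
begin

text \<open>
  The condition \<open>pr S ` Y \<subseteq> X\<close> says that \<open>Y\<close> lies in the preimage
  \<open>Z = {y \<in> K\<^sup>n. pr S y \<in> X}\<close>, so \<open>X\<^sup>S = Z\<close> is the candidate, and what has to be shown is that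
  \<open>Z\<close> has dimension \<open>d + 1\<close>. A nonzero Pluecker coordinate \<open>q\<^sub>C\<close> means that restriction to the
  coordinates in \<open>C\<close> is a bijection \<open>X \<rightarrow> K\<^sup>C\<close> (\<open>graph_over_of_plucker_nonzero\<close>). Since \<open>S \<subseteq> C\<close>, the
  preimage arises from \<open>X\<close> by replacing, inside \<open>K\<^sup>C\<close>, the coordinates in \<open>S\<close> by free ones, and
  restriction \<open>Z \<rightarrow> K\<^sup>C\<close> is again a bijection (\<open>graph_over_pr_preimage\<close>). Hence
  \<open>dim Z = card C = d + 1\<close>.

  The second claim holds because every nonzero element of \<open>\<Lambda>\<^sup>d Z\<close> is decomposable if \<open>Z\<close> has dimension
  \<open>d + 1\<close>, so that the Pluecker points of the hyperplanes of \<open>Z\<close> fill the projective space of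
  \<open>\<Lambda>\<^sup>d Z \<cong> K\<^bsup>d+1\<^esup>\<close>. In coordinates, let \<open>b\<^sub>0, \<dots>, b\<^sub>d\<close> be a basis of \<open>Z\<close> and let \<open>M\<^sub>i\<close> be
  \<open>(-1)\<^sup>i\<close> times the Pluecker vector of the basis without \<open>b\<^sub>i\<close>. By expansion along the first column,
  \<open>(\<Sum>i. c\<^sub>i M\<^sub>i) I\<close> is the determinant of \<open>[c | b\<^sub>I]\<close>, where \<open>b\<^sub>I\<close> consists of the columns \<open>I\<close> of the matrix
  with rows \<open>b\<^sub>i\<close>. If a hyperplane \<open>Y\<close> has a basis with coefficient matrix \<open>A\<close> and \<open>A c = 0\<close> with \<open>c \<noteq> 0\<close>,
  then adding to \<open>A\<close> a row \<open>u\<close> with \<open>u \<cdot> c = 1\<close> gives an invertible matrix whose product with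
  \<open>[c | b\<^sub>I]\<close> has first column \<open>(1, 0, \<dots>, 0)\<close> and complementary block \<open>A b\<^sub>I\<close>. So the Pluecker
  vector of \<open>Y\<close> is a nonzero multiple of \<open>\<Sum>i. c\<^sub>i M\<^sub>i\<close> (\<open>plucker_vector_of_annihilated\<close>). Each hyperplane
  has such a \<open>c\<close>, and each \<open>c \<noteq> 0\<close> belongs to the hyperplane that it annihilates. Finally, the \<open>M\<^sub>i\<close> are
  linearly independent (\<open>facet_vectors_independent\<close>): for the basis dual to the coordinates in \<open>C\<close>,
  their entries at the sets \<open>C - {x}\<close> with \<open>x \<in> C\<close> form a diagonal matrix of signs.
\<close>

section \<open>Linear algebra with families of coordinate vectors\<close>

lemma mult_delta_left: "(if P then a else 0) * x = (if P then a * x else 0)"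
  and mult_delta_right: "x * (if P then a else 0) = (if P then x * a else 0)"
  for a x :: "'a::mult_zero"
  by auto

lemma sum_apply: "(\<Sum>i\<in>A. f i) x = (\<Sum>i\<in>A. f i x)"
  for f :: "'a \<Rightarrow> 'b \<Rightarrow> 'c::comm_monoid_add"
  by (induction A rule: infinite_finite_induct) auto

lemma lincomb_apply: "(\<Sum>i\<in>A. fscale (c i) (b i)) x = (\<Sum>i\<in>A. c i * b i x)"
  by (simp add: sum_apply fscale_def)

text \<open>
  Independence of the set \<open>b ` {..<m}\<close> ignores repetitions; together with injectivity it is independence
  of the family, the form in which coefficient computations use it.
\<close>

lemma independent_family_iff:
  fixes b :: "nat \<Rightarrow> 'i \<Rightarrow> 'k::field"
  shows "inj_on b {..<m} \<and> fvs.independent (b ` {..<m}) \<longleftrightarrow>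
    (\<forall>c. (\<Sum>i<m. fscale (c i) (b i)) = 0 \<longrightarrow> (\<forall>i<m. c i = 0))"
proof (intro iffI allI impI conjI)
  fix c :: "nat \<Rightarrow> 'k" and i
  assume b: "inj_on b {..<m} \<and> fvs.independent (b ` {..<m})"
    and 0: "(\<Sum>i<m. fscale (c i) (b i)) = 0" and i: "i < m"
  have "(\<Sum>v\<in>b ` {..<m}. fscale (c (the_inv_into {..<m} b v)) v) = (\<Sum>i<m. fscale (c i) (b i))"
    using b by (subst sum.reindex) (auto simp: the_inv_into_f_f intro!: sum.cong)
  with 0 have "(\<Sum>v\<in>b ` {..<m}. fscale (c (the_inv_into {..<m} b v)) v) = 0"
    by simp
  from fvs.independentD[OF _ _ subset_refl this, of "b i"] b i
  show "c i = 0"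
    by (auto simp: the_inv_into_f_f)
next
  assume indep: "\<forall>c. (\<Sum>i<m. fscale (c i) (b i)) = 0 \<longrightarrow> (\<forall>i<m. c i = 0)"
  show inj: "inj_on b {..<m}"
  proof (rule inj_onI, rule ccontr)
    fix i j assume ij: "i \<in> {..<m}" "j \<in> {..<m}" "b i = b j" "i \<noteq> j"
    \<comment> \<open>A repeated vector gives the relation \<open>b i - b j = 0\<close>.\<close>
    define c :: "nat \<Rightarrow> 'k" where "c k = (if k = i then 1 else 0) - (if k = j then 1 else 0)" for k
    have "(\<Sum>k<m. fscale (c k) (b k)) = 0"
    proof
      fix x
      have "(\<Sum>k<m. c k * b k x) =
          (\<Sum>k<m. (if k = i then b k x else 0)) - (\<Sum>k<m. (if k = j then b k x else 0))"
        unfolding sum_subtractf[symmetric] by (intro sum.cong) (auto simp: c_def)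
      also have "\<dots> = 0" using ij by simp
      finally show "(\<Sum>k<m. fscale (c k) (b k)) x = 0 x" by (simp add: lincomb_apply)
    qed
    with indep ij have "c i = 0" by auto
    with ij show False by (simp add: c_def)
  qed
  show "fvs.independent (b ` {..<m})"
  proof (rule fvs.independent_if_scalars_zero)
    fix f v assume "(\<Sum>x\<in>b ` {..<m}. fscale (f x) x) = 0" and v: "v \<in> b ` {..<m}"
    hence "(\<Sum>i<m. fscale (f (b i)) (b i)) = 0"
      using inj by (simp add: sum.reindex)
    with indep[rule_format, of "\<lambda>i. f (b i)"] v show "f v = 0" by auto
  qed auto
qed

lemma span_family:
  fixes b :: "nat \<Rightarrow> 'i \<Rightarrow> 'k::field"
  shows "fvs.span (b ` {..<m}) = range (\<lambda>c. \<Sum>i<m. fscale (c i) (b i))"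
proof
  have "fvs.subspace (range (\<lambda>c. \<Sum>i<m. fscale (c i) (b i)))"
  proof (rule fvs.subspaceI)
    show "0 \<in> range (\<lambda>c. \<Sum>i<m. fscale (c i) (b i))"
      by (rule image_eqI[where x = "\<lambda>_. 0"]) (auto simp: fscale_def fun_eq_iff sum_apply)
  next
    fix x y assume "x \<in> range (\<lambda>c. \<Sum>i<m. fscale (c i) (b i))"
      and "y \<in> range (\<lambda>c. \<Sum>i<m. fscale (c i) (b i))"
    then obtain c c' where "x = (\<Sum>i<m. fscale (c i) (b i))" "y = (\<Sum>i<m. fscale (c' i) (b i))"
      by auto
    hence "x + y = (\<Sum>i<m. fscale (c i + c' i) (b i))"
      by (simp add: fvs.scale_left_distrib sum.distrib)
    thus "x + y \<in> range (\<lambda>c. \<Sum>i<m. fscale (c i) (b i))"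
      by (intro image_eqI[where x = "\<lambda>i. c i + c' i"]) auto
  next
    fix a x assume "x \<in> range (\<lambda>c. \<Sum>i<m. fscale (c i) (b i))"
    then obtain c where "x = (\<Sum>i<m. fscale (c i) (b i))" by auto
    hence "fscale a x = (\<Sum>i<m. fscale (a * c i) (b i))"
      by (simp add: fvs.scale_sum_right)
    thus "fscale a x \<in> range (\<lambda>c. \<Sum>i<m. fscale (c i) (b i))"
      by (intro image_eqI[where x = "\<lambda>i. a * c i"]) auto
  qed
  moreover have "b ` {..<m} \<subseteq> range (\<lambda>c. \<Sum>i<m. fscale (c i) (b i))"
  proof (intro image_subsetI)
    fix j assume "j \<in> {..<m}"
    hence "b j = (\<Sum>i<m. fscale (if i = j then 1 else 0) (b i))"
      by (intro ext) (simp add: lincomb_apply mult_delta_left)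
    thus "b j \<in> range (\<lambda>c. \<Sum>i<m. fscale (c i) (b i))"
      by (intro image_eqI[where x = "\<lambda>i. if i = j then 1 else 0"]) auto
  qed
  ultimately show "fvs.span (b ` {..<m}) \<subseteq> range (\<lambda>c. \<Sum>i<m. fscale (c i) (b i))"
    by (rule fvs.span_minimal[rotated])
next
  show "range (\<lambda>c. \<Sum>i<m. fscale (c i) (b i)) \<subseteq> fvs.span (b ` {..<m})"
    by (intro image_subsetI fvs.span_sum fvs.span_scale fvs.span_base imageI)
qed

lemma ordered_basis_independent:
  assumes "ordered_basis m b Y" "(\<Sum>i<m. fscale (c i) (b i)) = 0" "i < m"
  shows "c i = 0"
  using assms independent_family_iff[of b m] by (auto simp: ordered_basis_def)

lemma ordered_basis_coords:
  assumes "ordered_basis m b Y" "y \<in> Y"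
  obtains c where "y = (\<Sum>i<m. fscale (c i) (b i))"
proof -
  have "y \<in> range (\<lambda>c. \<Sum>i<m. fscale (c i) (b i))"
    using assms span_family[of b m] by (auto simp: ordered_basis_def)
  thus thesis by (auto intro: that)
qed

lemma ordered_basis_mem:
  assumes "ordered_basis m b Y" "i < m"
  shows "b i \<in> Y"
  using assms by (auto simp: ordered_basis_def intro: fvs.span_base)

lemma ordered_basis_subspace: "ordered_basis m b Y \<Longrightarrow> fvs.subspace Y"
  by (auto simp: ordered_basis_def)

lemma ordered_basis_dim: "ordered_basis m b Y \<Longrightarrow> fvs.dim Y = m"
  by (auto simp: ordered_basis_def fvs.dim_span_eq_card_independent card_image simp del: fvs.dim_span)

text \<open>
  The surrounding space \<open>Z\<close> makes every basis of \<open>Y\<close> finite. For an infinite basis, \<open>fvs.dim Y\<close> would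
  have the default value \<open>0\<close>.
\<close>

lemma ordered_basis_exists:
  assumes Y: "fvs.subspace Y" and Z: "ordered_basis m b Z" "Y \<subseteq> Z"
  obtains y where "ordered_basis (fvs.dim Y) y Y"
proof -
  obtain B where B: "B \<subseteq> Y" "fvs.independent B" "Y \<subseteq> fvs.span B" "card B = fvs.dim Y"
    by (rule fvs.basis_exists)
  have "B \<subseteq> fvs.span (b ` {..<m})" using B Z by (auto simp: ordered_basis_def)
  hence fin: "finite B" using fvs.independent_span_bound[of "b ` {..<m}" B] B by auto
  then obtain y where y: "bij_betw y {..<fvs.dim Y} B"
    using ex_bij_betw_nat_finite[of B] B by (auto simp: atLeast0LessThan)
  moreover have "fvs.span B = Y" using B Y by (simp add: fvs.span_minimal subset_antisym)
  ultimately have "ordered_basis (fvs.dim Y) y Y"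
    using B by (auto simp: ordered_basis_def bij_betw_def)
  thus thesis by (rule that)
qed

text \<open>
  A basis of the kernel becomes a basis of \<open>Z\<close> when one vector \<open>z\<close> outside the kernel is added, because
  subtracting \<open>(f x / f z) z\<close> moves any \<open>x\<close> into the kernel.
\<close>

lemma dim_kernel_of_functional:
  fixes f :: "(nat \<Rightarrow> 'k::field) \<Rightarrow> 'k"
  assumes Z: "ordered_basis (Suc d) b Z"
    and f: "\<And>x y. f (x + y) = f x + f y" "\<And>a x. f (fscale a x) = a * f x"
    and z: "z \<in> Z" "f z \<noteq> 0"
  shows "fvs.subspace {y \<in> Z. f y = 0}" "fvs.dim {y \<in> Z. f y = 0} = d"
proof -
  let ?Y = "{y \<in> Z. f y = 0}"
  have Zs: "fvs.subspace Z" using Z by (rule ordered_basis_subspace)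
  have f0: "f 0 = 0" using f(2)[of 0 0] by simp
  show sub: "fvs.subspace ?Y"
    using f f0 by (intro fvs.subspaceI)
      (auto intro: fvs.subspace_0 fvs.subspace_add fvs.subspace_scale Zs)
  obtain y where y: "ordered_basis (fvs.dim ?Y) y ?Y"
    using ordered_basis_exists[OF sub Z] by auto
  define B where "B = y ` {..<fvs.dim ?Y}"
  have B: "fvs.independent B" "fvs.span B = ?Y" "card B = fvs.dim ?Y" "finite B"
    using y by (auto simp: B_def ordered_basis_def card_image)
  have zB: "z \<notin> fvs.span B" using B z by auto
  have "fvs.independent (insert z B)"
    using B zB by (simp add: fvs.independent_insertI)
  moreover have "Z \<subseteq> fvs.span (insert z B)"
  proof
    fix x assume x: "x \<in> Z"
    let ?a = "f x / f z"
    have "f (x + fscale (- ?a) z) = 0" unfolding f using z by simp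
    moreover have "x + fscale (- ?a) z \<in> Z"
      using x z Zs by (intro fvs.subspace_add fvs.subspace_scale)
    ultimately have "x + fscale (- ?a) z \<in> fvs.span B" using B by simp
    hence "x - fscale ?a z \<in> fvs.span B" by simp
    thus "x \<in> fvs.span (insert z B)" by (auto simp: fvs.span_breakdown_eq)
  qed
  moreover have "insert z B \<subseteq> Z"
    using z B fvs.span_superset[of B] by auto
  ultimately have "fvs.dim Z = card (insert z B)"
    by (metis fvs.basis_card_eq_dim)
  also have "\<dots> = Suc (fvs.dim ?Y)"
    using B zB fvs.span_superset[of B] by (subst card_insert_disjoint) auto
  finally show "fvs.dim ?Y = d" using ordered_basis_dim[OF Z] by simp
qed

section \<open>Pluecker vectors\<close>

definition plucker_vector :: "nat \<Rightarrow> nat \<Rightarrow> (nat \<Rightarrow> nat \<Rightarrow> 'k::field) \<Rightarrow> nat set \<Rightarrow> 'k" where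
  "plucker_vector m n b I = (if I \<in> subsets_of_size n m
     then det (mat m m (\<lambda>(i, j). b i (sorted_list_of_set I ! j))) else 0)"

lemma plucker_coords_iff:
  "plucker_coords m n Y q \<longleftrightarrow> (\<exists>b. ordered_basis m b Y \<and> q = plucker_vector m n b)"
  by (auto simp: plucker_coords_def plucker_vector_def[abs_def])

lemma plucker_vector_change_of_basis:
  assumes "\<And>i. i < m \<Longrightarrow> b' i = (\<Sum>j<m. fscale (g i j) (b j))"
  shows "plucker_vector m n b' = fscale (det (mat m m (\<lambda>(i, j). g i j))) (plucker_vector m n b)"
proof
  fix I
  have "mat m m (\<lambda>(i, j). b' i (sorted_list_of_set I ! j)) =
      mat m m (\<lambda>(i, j). g i j) * mat m m (\<lambda>(i, j). b i (sorted_list_of_set I ! j))"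
    using assms by (intro eq_matI) (auto simp: lincomb_apply scalar_prod_def atLeast0LessThan)
  thus "plucker_vector m n b' I = fscale (det (mat m m (\<lambda>(i, j). g i j))) (plucker_vector m n b) I"
    by (simp add: plucker_vector_def fscale_def det_mult[where n = m])
qed

text \<open>
  The line defined by all bases of \<open>Y\<close> together is computed by any single one.
\<close>

lemma plucker_point_eq:
  assumes b: "ordered_basis d b Y"
  shows "plucker_point d n Y = fvs.span {plucker_vector d n b}"
proof -
  have "\<exists>k. plucker_vector d n b' = fscale k (plucker_vector d n b)" if b': "ordered_basis d b' Y" for b'
  proof -
    have "\<forall>i\<in>{..<d}. \<exists>c. b' i = (\<Sum>j<d. fscale (c j) (b j))"
      using ordered_basis_coords[OF b] ordered_basis_mem[OF b'] by (metis lessThan_iff)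
    then obtain g where "\<forall>i\<in>{..<d}. b' i = (\<Sum>j<d. fscale (g i j) (b j))"
      by metis
    thus ?thesis using plucker_vector_change_of_basis[of d b' g b n] by auto
  qed
  hence "{p. plucker_coords d n Y p} \<subseteq> fvs.span {plucker_vector d n b}"
    by (auto simp: plucker_coords_iff fvs.span_singleton)
  moreover have "plucker_vector d n b \<in> {p. plucker_coords d n Y p}"
    using b by (auto simp: plucker_coords_iff)
  ultimately show ?thesis
    unfolding plucker_point_def
    by (intro subset_antisym fvs.span_minimal fvs.span_mono) auto
qed

lemma span_singleton_scale:
  assumes "k \<noteq> 0"
  shows "fvs.span {fscale k w} = fvs.span {w}"
proof (intro subset_antisym fvs.span_minimal)
  have "w = fscale (inverse k) (fscale k w)" using assms by simp
  thus "{w} \<subseteq> fvs.span {fscale k w}"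
    by (metis empty_subsetI fvs.span_base fvs.span_scale insert_subset singletonI)
qed (auto intro: fvs.span_scale fvs.span_base)

section \<open>Subspaces that are graphs over coordinate subspaces\<close>

text \<open>
  Restriction to the coordinates in \<open>C\<close> is a bijection \<open>Y \<rightarrow> K\<^sup>C\<close>; for a subspace this means that \<open>Y\<close> is the
  graph of a linear map from \<open>K\<^sup>C\<close> to the space of the other coordinates. Only the values of \<open>v\<close> on \<open>C\<close>
  matter, so \<open>v\<close> ranges over all functions.
\<close>

definition graph_over :: "'i set \<Rightarrow> ('i \<Rightarrow> 'k::field) set \<Rightarrow> bool" where
  "graph_over C Y \<longleftrightarrow> (\<forall>v. \<exists>!y. y \<in> Y \<and> (\<forall>i\<in>C. y i = v i))"

lemma graph_over_lift:
  assumes "graph_over C Y"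
  obtains y where "y \<in> Y" "\<forall>i\<in>C. y i = v i"
proof -
  have "\<exists>!y. y \<in> Y \<and> (\<forall>i\<in>C. y i = v i)" using assms by (simp add: graph_over_def)
  thus thesis using that by (elim ex1E) blast
qed

lemma graph_over_unique:
  assumes "graph_over C Y" "x \<in> Y" "y \<in> Y" "\<forall>i\<in>C. x i = y i"
  shows "x = y"
proof -
  have "\<exists>!z. z \<in> Y \<and> (\<forall>i\<in>C. z i = y i)" using assms(1) by (simp add: graph_over_def)
  thus ?thesis using assms(2-4) by (elim ex1E) blast
qed

lemma subsets_of_size_sorted_list:
  assumes "C \<in> subsets_of_size n m"
  shows "set (sorted_list_of_set C) = C" "length (sorted_list_of_set C) = m"
    "distinct (sorted_list_of_set C)" "C = (!) (sorted_list_of_set C) ` {..<m}" "finite C"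
proof -
  show fin: "finite C" using assms by (auto simp: subsets_of_size_def intro: finite_subset)
  thus *: "set (sorted_list_of_set C) = C" "length (sorted_list_of_set C) = m"
    "distinct (sorted_list_of_set C)"
    using assms by (auto simp: subsets_of_size_def)
  thus "C = (!) (sorted_list_of_set C) ` {..<m}"
    by (metis atLeast0LessThan list.set_map map_nth set_upt)
qed

text \<open>
  In a basis of \<open>Y\<close>, restriction to \<open>C\<close> is given by the transpose \<open>T\<close> of the \<open>C\<close>-minor of that basis.
  As the minor is invertible, values on \<open>C\<close> can be prescribed, and they determine the vector.
\<close>

lemma graph_over_of_plucker_nonzero:
  assumes b: "ordered_basis m b Y" and C: "C \<in> subsets_of_size n m"
    and nz: "plucker_vector m n b C \<noteq> 0"
  shows "graph_over C Y"
proof -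
  let ?l = "(!) (sorted_list_of_set C)"
  define T where "T = mat m m (\<lambda>(j, i). b i (?l j))"
  have T: "T \<in> carrier_mat m m" by (simp add: T_def)
  have "T = transpose_mat (mat m m (\<lambda>(i, j). b i (?l j)))"
    by (intro eq_matI) (auto simp: T_def)
  hence det: "det T \<noteq> 0"
    using nz C by (simp add: plucker_vector_def det_transpose[where n = m])
  have val: "(T *\<^sub>v vec m c) $ j = (\<Sum>i<m. fscale (c i) (b i)) (?l j)" if "j < m" for c j
    using that by (simp add: T_def lincomb_apply scalar_prod_def atLeast0LessThan mult.commute)
  have Cl: "C = ?l ` {..<m}" using subsets_of_size_sorted_list[OF C] by blast
  have ex: "\<exists>y\<in>Y. \<forall>i\<in>C. y i = v i" for v
  proof -
    from adj_mat[OF T] have adj: "adj_mat T \<in> carrier_mat m m" "T * adj_mat T = det T \<cdot>\<^sub>m 1\<^sub>m m"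
      by auto
    \<comment> \<open>The inverse of \<open>T\<close> is \<open>adj_mat T / det T\<close>, so \<open>w\<close> are the coordinates of the vector sought.\<close>
    define w where "w = adj_mat T *\<^sub>v vec m (\<lambda>j. v (?l j) / det T)"
    have w: "w \<in> carrier_vec m" using adj by (auto simp: w_def)
    have "T *\<^sub>v w = (det T \<cdot>\<^sub>m 1\<^sub>m m) *\<^sub>v vec m (\<lambda>j. v (?l j) / det T)"
      unfolding w_def using adj T by (simp flip: assoc_mult_mat_vec)
    also have "\<dots> = vec m (\<lambda>j. v (?l j))"
      using det by (intro eq_vecI) (auto simp: scalar_prod_def mult_delta_left mult_delta_right
          simp flip: sum_divide_distrib)
    finally have Tw: "T *\<^sub>v w = vec m (\<lambda>j. v (?l j))" .
    have wv: "vec m (\<lambda>i. w $ i) = w" using w by auto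
    let ?y = "\<Sum>i<m. fscale (w $ i) (b i)"
    have "?y (?l j) = v (?l j)" if "j < m" for j
      using val[OF that, of "\<lambda>i. w $ i"] that by (simp add: wv Tw)
    moreover have "?y \<in> Y"
      using b span_family[of b m] by (auto simp: ordered_basis_def)
    ultimately show ?thesis using Cl by (metis (no_types, lifting) imageE lessThan_iff)
  qed
  have uniq: "x = y" if xy: "x \<in> Y" "y \<in> Y" "\<forall>i\<in>C. x i = y i" for x y
  proof -
    have "x - y \<in> Y" using xy ordered_basis_subspace[OF b] by (intro fvs.subspace_diff)
    then obtain c where c: "x - y = (\<Sum>i<m. fscale (c i) (b i))"
      using ordered_basis_coords[OF b] by blast
    have "T *\<^sub>v vec m c = 0\<^sub>v m"
    proof (rule eq_vecI)
      fix j assume "j < dim_vec (0\<^sub>v m)"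
      hence j: "j < m" by simp
      hence "?l j \<in> C" using Cl by blast
      thus "(T *\<^sub>v vec m c) $ j = 0\<^sub>v m $ j"
        using xy val[OF j, of c] j by (simp flip: c)
    qed (simp add: T_def)
    hence "vec m c = 0\<^sub>v m"
      using det det_0_iff_vec_prod_zero[OF T] vec_carrier by blast
    hence "c i = 0" if "i < m" for i using that by (metis index_vec index_zero_vec(1))
    hence "x - y = 0" unfolding c by (intro sum.neutral) auto
    thus "x = y" by simp
  qed
  show ?thesis unfolding graph_over_def
  proof (intro allI ex_ex1I)
    fix v show "\<exists>y. y \<in> Y \<and> (\<forall>i\<in>C. y i = v i)" using ex[of v] by auto
  qed (auto intro: uniq)
qed

text \<open>
  Lifting the unit vectors of \<open>K\<^sup>C\<close> gives a basis of \<open>Y\<close> whose \<open>C\<close>-minor is the identity matrix, and in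
  which the coefficients of a vector are its own coordinates in \<open>C\<close>.
\<close>

lemma graph_over_dual_basis:
  assumes g: "graph_over C Y" and Y: "fvs.subspace Y" and C: "C \<in> subsets_of_size n m"
  shows "\<exists>b. ordered_basis m b Y \<and>
    (\<forall>i<m. \<forall>j<m. b i (sorted_list_of_set C ! j) = (if i = j then 1 else 0)) \<and>
    (\<forall>y\<in>Y. y = (\<Sum>i<m. fscale (y (sorted_list_of_set C ! i)) (b i)))"
proof -
  let ?l = "(!) (sorted_list_of_set C)"
  note sl = subsets_of_size_sorted_list[OF C]
  have "\<exists>y. y \<in> Y \<and> (\<forall>k\<in>C. y k = (if k = ?l i then 1 else 0))" for i
    by (rule graph_over_lift[OF g, of "\<lambda>k. if k = ?l i then 1 else 0"]) blast
  hence "\<exists>b. \<forall>i. b i \<in> Y \<and> (\<forall>k\<in>C. b i k = (if k = ?l i then 1 else 0))"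
    by (intro choice allI)
  then obtain b where b: "b i \<in> Y" "k \<in> C \<Longrightarrow> b i k = (if k = ?l i then 1 else 0)" for i k
    by auto
  have dual: "b i (?l j) = (if i = j then 1 else 0)" if "i < m" "j < m" for i j
  proof -
    have "?l j \<in> C" using that sl(1,2) nth_mem[of j "sorted_list_of_set C"] by simp
    thus ?thesis using that sl(2,3) b(2)[of "?l j" i] by (auto simp: nth_eq_iff_index_eq)
  qed
  have val: "(\<Sum>i<m. fscale (c i) (b i)) (?l j) = c j" if "j < m" for c j
  proof -
    have "(\<Sum>i<m. c i * b i (?l j)) = (\<Sum>i<m. if i = j then c i else 0)"
      using dual that by (intro sum.cong) auto
    thus ?thesis using that by (simp add: lincomb_apply)
  qed
  have in_Y: "(\<Sum>i<m. fscale (c i) (b i)) \<in> Y" for c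
    using b Y by (intro fvs.subspace_sum fvs.subspace_scale) auto
  have exp: "y = (\<Sum>i<m. fscale (y (?l i)) (b i))" if y: "y \<in> Y" for y
  proof -
    have "y k = (\<Sum>i<m. fscale (y (?l i)) (b i)) k" if "k \<in> C" for k
    proof -
      obtain j where "j < m" "k = ?l j" using \<open>k \<in> C\<close> sl(4) by blast
      thus ?thesis using val[of j "\<lambda>i. y (?l i)"] by simp
    qed
    thus ?thesis by (intro graph_over_unique[OF g y in_Y]) blast
  qed
  have "\<forall>i<m. c i = 0" if "(\<Sum>i<m. fscale (c i) (b i)) = 0" for c
    using val[of _ c] that by simp
  hence "inj_on b {..<m} \<and> fvs.independent (b ` {..<m})"
    by (subst independent_family_iff) auto
  moreover have "fvs.span (b ` {..<m}) = Y"
    unfolding span_family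
  proof (intro subset_antisym subsetI)
    fix y assume "y \<in> Y"
    from exp[OF this] show "y \<in> range (\<lambda>c. \<Sum>i<m. fscale (c i) (b i))"
      by (rule range_eqI[where x = "\<lambda>i. y (?l i)"])
  qed (use in_Y in auto)
  ultimately have "ordered_basis m b Y" by (auto simp: ordered_basis_def)
  with dual exp show ?thesis by blast
qed

lemma pr_linear: "pr S (x + y) = pr S x + pr S y" "pr S (fscale c x) = fscale c (pr S x)" "pr S 0 = 0"
  by (auto simp: pr_def fscale_def)

lemma subspace_pr_preimage:
  assumes "fvs.subspace X"
  shows "fvs.subspace {y \<in> coord_space A. pr S y \<in> X}"
  using assms by (intro fvs.subspaceI)
    (auto simp: pr_linear coord_space_def fvs.subspace_0 fvs.subspace_add fvs.subspace_scale,
      simp add: fscale_def)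

text \<open>
  To lift \<open>v\<close>, take the element of \<open>X\<close> that vanishes on \<open>S\<close> and agrees with \<open>v\<close> on \<open>C - S\<close>, and overwrite
  its coordinates in \<open>S\<close> by those of \<open>v\<close>; \<open>pr S\<close> undoes the overwriting. Uniqueness is inherited
  from \<open>X\<close> outside \<open>S\<close>, and inside \<open>S\<close> it holds because \<open>S \<subseteq> C\<close>.
\<close>

lemma graph_over_pr_preimage:
  fixes X :: "(nat \<Rightarrow> 'k::field) set"
  assumes g: "graph_over C X" and X: "X \<subseteq> coord_space A" and S: "S \<subseteq> C" "C \<subseteq> A"
  shows "graph_over C {y \<in> coord_space A. pr S y \<in> X}"
  unfolding graph_over_def
proof (intro allI ex_ex1I)
  fix v :: "nat \<Rightarrow> 'k"
  obtain x where x: "x \<in> X" "\<forall>i\<in>C. x i = pr S v i"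
    by (rule graph_over_lift[OF g])
  define y where "y i = (if i \<in> S then v i else x i)" for i
  have "pr S y = x" using x S by (auto simp: y_def pr_def fun_eq_iff)
  moreover have "y \<in> coord_space A" using x X S by (auto simp: coord_space_def y_def)
  moreover have "\<forall>i\<in>C. y i = v i" using x by (auto simp: y_def pr_def)
  ultimately show "\<exists>y. y \<in> {y \<in> coord_space A. pr S y \<in> X} \<and> (\<forall>i\<in>C. y i = v i)"
    using x by auto
next
  fix v :: "nat \<Rightarrow> 'k" and y z
  assume y: "y \<in> {y \<in> coord_space A. pr S y \<in> X} \<and> (\<forall>i\<in>C. y i = v i)"
    and z: "z \<in> {y \<in> coord_space A. pr S y \<in> X} \<and> (\<forall>i\<in>C. z i = v i)"
  have "\<forall>i\<in>C. pr S y i = pr S z i" using y z by (auto simp: pr_def)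
  hence "pr S y = pr S z"
    using y z by (intro graph_over_unique[OF g]) auto
  hence "y i = z i" if "i \<notin> S" for i using that by (metis pr_def)
  thus "y = z" using y z S by (metis ext subsetD)
qed

section \<open>Pluecker vectors of the hyperplanes of a subspace\<close>

text \<open>
  Up to sign, the Pluecker vector of the facet of \<open>b\<^sub>0, \<dots>, b\<^sub>d\<close> that omits \<open>b\<^sub>i\<close>. The sign is that
  of the cofactors of a first column, which turns linear combinations of facet vectors into determinants.
\<close>

definition facet_vector :: "nat \<Rightarrow> nat \<Rightarrow> (nat \<Rightarrow> nat \<Rightarrow> 'k::field) \<Rightarrow> nat \<Rightarrow> nat set \<Rightarrow> 'k" where
  "facet_vector d n b i =
     fscale ((-1) ^ i) (plucker_vector d n (\<lambda>r. b (if r < i then r else Suc r)))"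

lemma facet_lincomb_eq_det:
  assumes I: "I \<in> subsets_of_size n d"
  shows "(\<Sum>i<Suc d. fscale (c i) (facet_vector d n b i)) I =
    det (mat (Suc d) (Suc d) (\<lambda>(i, j). if j = 0 then c i else b i (sorted_list_of_set I ! (j - 1))))"
    (is "_ = det ?N")
proof -
  have N: "?N \<in> carrier_mat (Suc d) (Suc d)" by simp
  have "?N $$ (i, 0) * cofactor ?N i 0 = c i * facet_vector d n b i I" if i: "i < Suc d" for i
  proof -
    have "mat_delete ?N i 0 =
        mat d d (\<lambda>(r, j). b (if r < i then r else Suc r) (sorted_list_of_set I ! j))"
      using i by (intro eq_matI) (auto simp: mat_delete_def)
    thus ?thesis using i I
      by (simp add: cofactor_def facet_vector_def fscale_def plucker_vector_def)
  qed
  hence "(\<Sum>i<Suc d. ?N $$ (i, 0) * cofactor ?N i 0) = (\<Sum>i<Suc d. c i * facet_vector d n b i I)"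
    by (intro sum.cong) auto
  thus ?thesis
    unfolding lincomb_apply laplace_expansion_column[OF N zero_less_Suc] by simp
qed

text \<open>
  A subspace of dimension \<open>d\<close> in the span of \<open>b\<^sub>0, \<dots>, b\<^sub>d\<close> has, up to a nonzero factor, the Pluecker vector
  \<open>\<Sum>i. c\<^sub>i M\<^sub>i\<close>, where \<open>c\<close> is a linear relation between the coordinates of its elements. The factor is
  the determinant of the coefficient matrix enlarged by a first row \<open>u\<close> with \<open>u \<cdot> c = 1\<close>.
\<close>

lemma plucker_vector_of_annihilated:
  fixes b :: "nat \<Rightarrow> nat \<Rightarrow> 'k::field"
  assumes y: "\<And>j. j < d \<Longrightarrow> y j = (\<Sum>i<Suc d. fscale (a j i) (b i))"
    and indep: "\<And>c. (\<Sum>j<d. fscale (c j) (y j)) = 0 \<Longrightarrow> \<forall>j<d. c j = 0"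
    and ann: "\<And>j. j < d \<Longrightarrow> (\<Sum>i<Suc d. a j i * c i) = 0"
    and c: "k < Suc d" "c k \<noteq> 0"
  obtains \<delta> where "\<delta> \<noteq> 0"
    and "plucker_vector d n y = fscale \<delta> (\<Sum>i<Suc d. fscale (c i) (facet_vector d n b i))"
proof -
  \<comment> \<open>The first row is \<open>u\<close>, chosen as the \<open>k\<close>-th unit vector divided by \<open>c k\<close>.\<close>
  define Q where "Q = mat (Suc d) (Suc d) (\<lambda>(i, j).
    if i = 0 then (if j = k then inverse (c k) else 0) else a (i - 1) j)"
  have Q: "Q \<in> carrier_mat (Suc d) (Suc d)" by (simp add: Q_def)
  have Qc: "(\<Sum>j<Suc d. Q $$ (i, j) * c j) = (if i = 0 then 1 else 0)" if i: "i < Suc d" for i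
  proof (cases i)
    case 0
    have "(\<Sum>j<Suc d. Q $$ (0, j) * c j) = (\<Sum>j<Suc d. if j = k then 1 else 0)"
      using c by (intro sum.cong) (auto simp: Q_def)
    thus ?thesis using 0 c by (simp del: sum.lessThan_Suc)
  next
    case (Suc i')
    have "(\<Sum>j<Suc d. Q $$ (i, j) * c j) = (\<Sum>j<Suc d. a i' j * c j)"
      using Suc i by (intro sum.cong) (auto simp: Q_def)
    thus ?thesis using ann[of i'] Suc i by simp
  qed
  have "det Q \<noteq> 0"
  proof
    assume "det Q = 0"
    hence "det (transpose_mat Q) = 0" using Q by (simp add: det_transpose)
    then obtain v where v: "v \<in> carrier_vec (Suc d)" "v \<noteq> 0\<^sub>v (Suc d)"
      "transpose_mat Q *\<^sub>v v = 0\<^sub>v (Suc d)"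
      using det_0_iff_vec_prod_zero[of "transpose_mat Q" "Suc d"] Q by auto
    have vQ: "(\<Sum>i<Suc d. v $ i * Q $$ (i, j)) = 0" if j: "j < Suc d" for j
    proof -
      have "(\<Sum>i<Suc d. v $ i * Q $$ (i, j)) = (transpose_mat Q *\<^sub>v v) $ j"
        using j v(1) Q by (simp add: scalar_prod_def atLeast0LessThan mult.commute[of "v $ _"]
            del: sum.lessThan_Suc)
      thus ?thesis using v(3) j by simp
    qed
    \<comment> \<open>If \<open>v Q = 0\<close>, then \<open>v\<^sub>0 = v (Q c) = 0\<close>, and the rest of \<open>v\<close> is a linear relation between the
      rows of \<open>a\<close>, which the independence of the \<open>y j\<close> excludes.\<close>
    have "v $ 0 = (\<Sum>i<Suc d. v $ i * (if i = 0 then 1 else 0))"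
      by (simp add: mult_delta_right del: sum.lessThan_Suc)
    also have "\<dots> = (\<Sum>i<Suc d. v $ i * (\<Sum>j<Suc d. Q $$ (i, j) * c j))"
      using Qc by (intro sum.cong) auto
    also have "\<dots> = (\<Sum>i<Suc d. \<Sum>j<Suc d. v $ i * Q $$ (i, j) * c j)"
      by (simp add: sum_distrib_left mult.assoc del: sum.lessThan_Suc)
    also have "\<dots> = (\<Sum>j<Suc d. (\<Sum>i<Suc d. v $ i * Q $$ (i, j)) * c j)"
      unfolding sum_distrib_right by (rule sum.swap)
    also have "\<dots> = 0" using vQ by (intro sum.neutral) auto
    finally have v0: "v $ 0 = 0" .
    have va: "(\<Sum>j<d. v $ Suc j * a j i) = 0" if i: "i < Suc d" for i
      using vQ[OF i] v0 i unfolding sum.lessThan_Suc_shift by (simp add: Q_def)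
    have "(\<Sum>j<d. fscale (v $ Suc j) (y j)) = 0"
    proof
      fix x
      have "(\<Sum>j<d. v $ Suc j * y j x) = (\<Sum>j<d. v $ Suc j * (\<Sum>i<Suc d. a j i * b i x))"
        using y by (intro sum.cong) (auto simp: lincomb_apply simp del: sum.lessThan_Suc)
      also have "\<dots> = (\<Sum>j<d. \<Sum>i<Suc d. v $ Suc j * a j i * b i x)"
        by (simp add: sum_distrib_left mult.assoc del: sum.lessThan_Suc)
      also have "\<dots> = (\<Sum>i<Suc d. (\<Sum>j<d. v $ Suc j * a j i) * b i x)"
        unfolding sum_distrib_right by (rule sum.swap)
      also have "\<dots> = 0" using va by (intro sum.neutral) auto
      finally show "(\<Sum>j<d. fscale (v $ Suc j) (y j)) x = 0 x" by (simp add: lincomb_apply)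
    qed
    hence "\<forall>j<d. v $ Suc j = 0" by (rule indep)
    hence "v = 0\<^sub>v (Suc d)"
      using v v0 by (intro eq_vecI) (auto simp: less_Suc_eq_0_disj)
    with v show False by simp
  qed
  moreover have "plucker_vector d n y =
    fscale (det Q) (\<Sum>i<Suc d. fscale (c i) (facet_vector d n b i))" (is "_ = fscale _ ?w")
  proof
    fix I
    show "plucker_vector d n y I = fscale (det Q) ?w I"
    proof (cases "I \<in> subsets_of_size n d")
      case False
      thus ?thesis
        by (simp add: plucker_vector_def fscale_def lincomb_apply facet_vector_def sum_apply
            del: sum.lessThan_Suc)
    next
      case I: True
      let ?l = "(!) (sorted_list_of_set I)"
      define N where
        "N = mat (Suc d) (Suc d) (\<lambda>(i, j). if j = 0 then c i else b i (?l (j - 1)))"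
      have N: "N \<in> carrier_mat (Suc d) (Suc d)" by (simp add: N_def)
      have QN: "Q * N \<in> carrier_mat (Suc d) (Suc d)" using Q N by simp
      have col: "(Q * N) $$ (i, 0) = (if i = 0 then 1 else 0)" if i: "i < Suc d" for i
        using i Q N Qc[OF i]
        by (simp add: scalar_prod_def atLeast0LessThan N_def del: sum.lessThan_Suc)
      \<comment> \<open>The first column of \<open>Q N\<close> is the first unit vector, so its determinant is the complementary minor,
        and that is the minor of \<open>y\<close> at \<open>I\<close>.\<close>
      have "mat_delete (Q * N) 0 0 = mat d d (\<lambda>(i, j). y i (?l j))"
      proof (rule eq_matI)
        fix i j assume "i < dim_row (mat d d (\<lambda>(i, j). y i (?l j)))"
          "j < dim_col (mat d d (\<lambda>(i, j). y i (?l j)))"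
        hence ij: "i < d" "j < d" by auto
        have "(Q * N) $$ (Suc i, Suc j) = (\<Sum>r<Suc d. a i r * b r (?l j))"
          using ij Q N by (simp add: scalar_prod_def atLeast0LessThan N_def Q_def
              del: sum.lessThan_Suc)
        thus "mat_delete (Q * N) 0 0 $$ (i, j) = mat d d (\<lambda>(i, j). y i (?l j)) $$ (i, j)"
          using ij Q N y[OF ij(1)]
          by (simp add: mat_delete_def lincomb_apply del: sum.lessThan_Suc)
      qed (use Q N in auto)
      hence "det (mat d d (\<lambda>(i, j). y i (?l j))) = cofactor (Q * N) 0 0"
        by (simp add: cofactor_def)
      also have "\<dots> = (\<Sum>i<Suc d. (if i = 0 then 1 else 0) * cofactor (Q * N) i 0)"
        by (simp add: mult_delta_left del: sum.lessThan_Suc)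
      also have "\<dots> = (\<Sum>i<Suc d. (Q * N) $$ (i, 0) * cofactor (Q * N) i 0)"
        using col by (intro sum.cong) auto
      also have "\<dots> = det (Q * N)"
        by (rule laplace_expansion_column[OF QN, symmetric]) simp
      also have "\<dots> = det Q * ?w I"
        using det_mult[OF Q N] facet_lincomb_eq_det[OF I, of c b] by (simp only: N_def)
      finally show ?thesis using I by (simp add: plucker_vector_def fscale_def)
    qed
  qed
  ultimately show thesis by (rule that)
qed

text \<open>
  Fewer equations than unknowns: a zero row makes the coefficient matrix square and singular.
\<close>

lemma common_annihilator_exists:
  fixes a :: "nat \<Rightarrow> nat \<Rightarrow> 'k::field"
  shows "\<exists>c. (\<exists>k<Suc d. c k \<noteq> 0) \<and> (\<forall>j<d. (\<Sum>i<Suc d. a j i * c i) = 0)"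
proof -
  define M where "M = mat (Suc d) (Suc d) (\<lambda>(i, j). if i < d then a i j else 0)"
  have M: "M \<in> carrier_mat (Suc d) (Suc d)" by (simp add: M_def)
  have "det M = (\<Sum>j<Suc d. M $$ (d, j) * cofactor M d j)"
    by (rule laplace_expansion_row[OF M]) simp
  also have "\<dots> = 0" by (intro sum.neutral) (auto simp: M_def)
  finally obtain v where v: "v \<in> carrier_vec (Suc d)" "v \<noteq> 0\<^sub>v (Suc d)" "M *\<^sub>v v = 0\<^sub>v (Suc d)"
    using det_0_iff_vec_prod_zero[OF M] by auto
  have "\<exists>k<Suc d. v $ k \<noteq> 0"
  proof (rule ccontr)
    assume "\<not> (\<exists>k<Suc d. v $ k \<noteq> 0)"
    hence "v = 0\<^sub>v (Suc d)" using v by (intro eq_vecI) auto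
    with v show False by simp
  qed
  then obtain k where k: "k < Suc d" "v $ k \<noteq> 0" by auto
  have "(\<Sum>i<Suc d. a j i * v $ i) = 0" if j: "j < d" for j
  proof -
    have "(M *\<^sub>v v) $ j = 0" using v j by simp
    thus ?thesis using j v
      by (simp add: M_def scalar_prod_def atLeast0LessThan del: sum.lessThan_Suc)
  qed
  with k show ?thesis by (intro exI[of _ "\<lambda>i. v $ i"]) blast
qed

lemma nth_sorted_list_of_set_remove:
  assumes "finite C" "k < card C"
  shows "sorted_list_of_set (C - {sorted_list_of_set C ! k}) ! j =
    sorted_list_of_set C ! (if j < k then j else Suc j)"
proof -
  let ?l = "sorted_list_of_set C"
  have len: "k < length ?l" using assms by simp
  have split: "?l = take k ?l @ ?l ! k # drop (Suc k) ?l"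
    using len by (rule id_take_nth_drop)
  have "?l ! k \<notin> set (take k ?l)"
    using len by (metis distinct_sorted_list_of_set distinct_take not_distinct_conv_prefix
        take_Suc_conv_app_nth)
  hence "remove1 (?l ! k) ?l = take k ?l @ drop (Suc k) ?l"
    by (subst split) (simp add: remove1_append)
  thus ?thesis
    using assms len by (auto simp: sorted_list_of_set_remove nth_append)
qed

text \<open>
  The facet vectors are evaluated at the sets \<open>C\<close> minus one element. Since the \<open>C\<close>-minor of \<open>b\<close> is the
  identity matrix, the entries there are signed cofactors of the identity, which vanish off the diagonal.
\<close>

lemma facet_vectors_independent:
  fixes b :: "nat \<Rightarrow> nat \<Rightarrow> 'k::field"
  assumes C: "C \<in> subsets_of_size n (Suc d)"
    and dual: "\<And>i j. i < Suc d \<Longrightarrow> j < Suc d \<Longrightarrow>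
      b i (sorted_list_of_set C ! j) = (if i = j then 1 else 0)"
    and 0: "(\<Sum>i<Suc d. fscale (c i) (facet_vector d n b i)) = 0" and k: "k < Suc d"
  shows "c k = 0"
proof -
  note sl = subsets_of_size_sorted_list[OF C]
  let ?l = "(!) (sorted_list_of_set C)"
  let ?I = "C - {?l k}"
  have lk: "?l k \<in> C" using sl k by (metis nth_mem)
  hence I: "?I \<in> subsets_of_size n d" using C sl by (auto simp: subsets_of_size_def)
  have "facet_vector d n b i ?I = (if i = k then (-1) ^ k else 0)" if i: "i < Suc d" for i
  proof -
    have "mat d d (\<lambda>(r, j). b (if r < i then r else Suc r) (sorted_list_of_set ?I ! j)) =
        mat_delete (1\<^sub>m (Suc d)) i k"
      using i k dual C sl
      by (intro eq_matI) (auto simp: mat_delete_def nth_sorted_list_of_set_remove subsets_of_size_def)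
    hence "facet_vector d n b i ?I = (-1) ^ k * (adj_mat (1\<^sub>m (Suc d)) $$ (k, i) :: 'k)"
      using i k I by (simp add: facet_vector_def fscale_def plucker_vector_def adj_mat_def
          cofactor_def power_add)
    also have "adj_mat (1\<^sub>m (Suc d)) = (1\<^sub>m (Suc d) :: 'k mat)"
      using adj_mat[of "1\<^sub>m (Suc d) :: 'k mat" "Suc d"] by (auto intro!: eq_matI)
    finally show ?thesis using i k by simp
  qed
  hence "(\<Sum>i<Suc d. c i * facet_vector d n b i ?I) = (\<Sum>i<Suc d. if i = k then c i * (-1) ^ k else 0)"
    by (intro sum.cong) auto
  also have "\<dots> = c k * (-1) ^ k" using k by (simp del: sum.lessThan_Suc)
  finally have "c k * (-1) ^ k = (\<Sum>i<Suc d. fscale (c i) (facet_vector d n b i)) ?I"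
    by (simp add: lincomb_apply del: sum.lessThan_Suc)
  thus ?thesis unfolding 0 by simp
qed

text \<open>
  The linear space is spanned by the facet vectors of the basis of \<open>Z\<close> dual to the coordinates in \<open>C\<close>.
  The coefficients of \<open>y \<in> Z\<close> in that basis are its coordinates in \<open>C\<close>, so hyperplanes of \<open>Z\<close> and
  coefficient vectors \<open>c \<noteq> 0\<close> correspond via the equation \<open>\<Sum>i. c\<^sub>i y\<^sub>i = 0\<close> in these coordinates.
\<close>

lemma linear_subvariety_of_hyperplanes:
  fixes Z :: "(nat \<Rightarrow> 'k::field) set"
  assumes Z: "Z \<subseteq> coord_space {1..n}" "fvs.subspace Z"
    and C: "C \<in> subsets_of_size n (Suc d)" and g: "graph_over C Z"
  shows "linear_subvariety (subsets_of_size n d) d (plucker_point d n ` L d n Z)"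
proof -
  let ?l = "(!) (sorted_list_of_set C)"
  obtain b where b: "ordered_basis (Suc d) b Z"
    and dual': "\<forall>i<Suc d. \<forall>j<Suc d. b i (?l j) = (if i = j then 1 else 0)"
    and exp: "\<forall>y\<in>Z. y = (\<Sum>i<Suc d. fscale (y (?l i)) (b i))"
    using graph_over_dual_basis[OF g Z(2) C] by blast
  have dual: "b i (?l j) = (if i = j then 1 else 0)" if "i < Suc d" "j < Suc d" for i j
    using dual' that by blast
  define M where "M = facet_vector d n b"
  let ?w = "\<lambda>c. \<Sum>i<Suc d. fscale (c i) (M i)"
  define W where "W = fvs.span (M ` {..<Suc d})"
  have indep: "c k = 0" if "?w c = 0" "k < Suc d" for c k
    using facet_vectors_independent[OF C dual, of c k] that unfolding M_def by blast
  have W: "W = range ?w" by (simp add: W_def span_family del: sum.lessThan_Suc)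
  have "inj_on M {..<Suc d} \<and> fvs.independent (M ` {..<Suc d})"
    using independent_family_iff[of M "Suc d"] indep by blast
  hence "fvs.dim W = d + 1"
    unfolding W_def by (metis Suc_eq_plus1 card_image card_lessThan fvs.dim_span_eq_card_independent)
  have LZ: "Y \<in> L d n Z \<longleftrightarrow> Y \<subseteq> Z \<and> fvs.subspace Y \<and> fvs.dim Y = d" for Y
    using Z by (auto simp: L_def LS_def Gr_def pr_def)
  have point: "plucker_point d n Y = fvs.span {?w c}"
    if Y: "Y \<subseteq> Z" and y: "ordered_basis d y Y" and c: "k < Suc d" "c k \<noteq> 0"
      and ann: "\<And>j. j < d \<Longrightarrow> (\<Sum>i<Suc d. y j (?l i) * c i) = 0" for Y y c k
  proof -
    obtain \<delta> where "\<delta> \<noteq> 0" "plucker_vector d n y = fscale \<delta> (?w c)"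
      unfolding M_def
    proof (rule plucker_vector_of_annihilated[where a = "\<lambda>j i. y j (?l i)" and y = y and b = b and c = c
          and d = d])
      show "y j = (\<Sum>i<Suc d. fscale (y j (?l i)) (b i))" if "j < d" for j
        using exp Y ordered_basis_mem[OF y that] by blast
      show "\<forall>j<d. a j = 0" if "(\<Sum>j<d. fscale (a j) (y j)) = 0" for a
        using ordered_basis_independent[OF y that] by blast
    qed (use c ann in auto)
    thus ?thesis by (simp add: plucker_point_eq[OF y] span_singleton_scale del: sum.lessThan_Suc)
  qed
  have "plucker_point d n ` L d n Z = projectivization W"
  proof (intro subset_antisym subsetI)
    fix P assume "P \<in> plucker_point d n ` L d n Z"
    then obtain Y where Y: "P = plucker_point d n Y" "Y \<subseteq> Z" "fvs.subspace Y" "fvs.dim Y = d"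
      by (auto simp: LZ)
    obtain y where y: "ordered_basis d y Y"
      using ordered_basis_exists[OF Y(3) b Y(2)] Y(4) by auto
    obtain c k where c: "k < Suc d" "c k \<noteq> 0"
      and ann: "\<forall>j<d. (\<Sum>i<Suc d. y j (?l i) * c i) = 0"
      using common_annihilator_exists[of d "\<lambda>j i. y j (?l i)"] by blast
    have "?w c \<noteq> 0" using indep c by blast
    thus "P \<in> projectivization W"
      using point[OF Y(2) y c ann[rule_format]] Y(1) W by (auto simp: projectivization_def)
  next
    fix P assume "P \<in> projectivization W"
    then obtain c where P: "P = fvs.span {?w c}" and "?w c \<noteq> 0"
      unfolding projectivization_def W by blast
    then obtain k where k: "k < Suc d" "c k \<noteq> 0"
      by (metis (no_types, lifting) fvs.scale_zero_left lessThan_iff sum.neutral)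
    define f where "f x = (\<Sum>i<Suc d. x (?l i) * c i)" for x
    let ?Y = "{y \<in> Z. f y = 0}"
    have f_add: "f (x + y) = f x + f y" for x y
      by (simp add: f_def algebra_simps sum.distrib del: sum.lessThan_Suc)
    have f_scale: "f (fscale a x) = a * f x" for a x
      by (simp add: f_def fscale_def sum_distrib_left mult.assoc del: sum.lessThan_Suc)
    have "f (b k) = (\<Sum>i<Suc d. if i = k then c i else 0)"
      unfolding f_def using dual k by (intro sum.cong) auto
    hence "f (b k) \<noteq> 0" using k by (simp del: sum.lessThan_Suc)
    from dim_kernel_of_functional[OF b f_add f_scale ordered_basis_mem[OF b k(1)] this]
    have Y: "fvs.subspace ?Y" "fvs.dim ?Y = d" by auto
    obtain y where y: "ordered_basis d y ?Y"
      using ordered_basis_exists[OF Y(1) b] Y(2) by auto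
    have "(\<Sum>i<Suc d. y j (?l i) * c i) = 0" if "j < d" for j
      using ordered_basis_mem[OF y that] by (simp add: f_def del: sum.lessThan_Suc)
    from point[OF _ y k this] have "P = plucker_point d n ?Y" using P by auto
    moreover have "?Y \<in> L d n Z" using Y by (auto simp: LZ)
    ultimately show "P \<in> plucker_point d n ` L d n Z" by blast
  qed
  moreover have "W \<subseteq> coord_space (subsets_of_size n d)"
    unfolding W by (auto simp: coord_space_def lincomb_apply M_def facet_vector_def fscale_def sum_apply
        plucker_vector_def simp del: sum.lessThan_Suc)
  moreover have "fvs.subspace W" unfolding W_def by (rule fvs.subspace_span)
  ultimately show ?thesis
    unfolding linear_subvariety_def using \<open>fvs.dim W = d + 1\<close> by blast
qed

theorem theorem1:
  fixes X :: "(nat \<Rightarrow> 'k::alg_closed_field) set"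
    and q :: "nat set \<Rightarrow> 'k"
    and S :: "nat set"
    and d n :: nat
  assumes "1 \<le> d" and "d \<le> n - 1"
    and "X \<in> Gr (d + 1) n"
    and "plucker_coords (d + 1) n X q"
    and "S \<subseteq> {1..n}"
    and "\<exists>C \<in> subsets_of_size n (d + 1). S \<subseteq> C \<and> q C \<noteq> 0"
  shows "(\<exists>XS \<in> Gr (d + 1) n. LS d n S X = L d n XS) \<and>
    linear_subvariety (subsets_of_size n d) d (plucker_point d n ` LS d n S X)"
proof -
  let ?Z = "{y \<in> coord_space {1..n}. pr S y \<in> X}"
  obtain C where C: "C \<in> subsets_of_size n (Suc d)" "S \<subseteq> C" "q C \<noteq> 0"
    using assms(6) by auto
  obtain b where b: "ordered_basis (Suc d) b X" "q = plucker_vector (Suc d) n b"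
    using assms(4) by (auto simp: plucker_coords_iff)
  have X: "X \<subseteq> coord_space {1..n}" "fvs.subspace X"
    using assms(3) by (auto simp: Gr_def)
  have "graph_over C X"
    using graph_over_of_plucker_nonzero[OF b(1) C(1)] C(3) b(2) by simp
  hence g: "graph_over C ?Z"
    using graph_over_pr_preimage[of C X "{1..n}" S] X C by (auto simp: subsets_of_size_def)
  have Z: "?Z \<subseteq> coord_space {1..n}" "fvs.subspace ?Z"
    using subspace_pr_preimage[OF X(2)] by auto
  obtain b' where "ordered_basis (Suc d) b' ?Z"
    using graph_over_dual_basis[OF g Z(2) C(1)] by blast
  hence "fvs.dim ?Z = d + 1" using ordered_basis_dim by fastforce
  hence "?Z \<in> Gr (d + 1) n" using Z by (auto simp: Gr_def)
  moreover have eq: "LS d n S X = L d n ?Z"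
    by (auto simp: L_def LS_def Gr_def pr_def)
  moreover have "linear_subvariety (subsets_of_size n d) d (plucker_point d n ` LS d n S X)"
    unfolding eq by (rule linear_subvariety_of_hyperplanes[OF Z C(1) g])
  ultimately show ?thesis by blast
qed

end
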